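(* Fix a tree partition $\langle A_s\rangle$ of $\omega$ and let $\mathbb B=\mathcal P(\omega)/\mathcal H$. The map \[ \Phi([B]_{\mathrm{Fin}})=\Bigl[\bigcup_{n\in B}A_{\langle n\rangle}\Bigr]_{\mathcal H} \] is a (well-defined) unital Boolean embedding of $\mathcal P(\omega)/\mathrm{Fin}$ into $\mathbb B$, and \[ \pi([X]_{\mathcal H})=\bigl[\{n:X\cap A_{\langle n\rangle}\notin\mathcal H(\langle n\rangle)\}\bigr]_{\mathrm{Fin}} \] is a forcing projection from $\mathbb B\setminus\{0\}$ to $(\mathcal P(\omega)/\mathrm{Fin})^+$ with $\pi\circ\Phi=\mathrm{id}$. The copy $\Phi[\mathcal P(\omega)/\mathrm{Fin}]$ is a regular subalgebra of $\mathbb B$, and the forcing $\mathbb Q_{\mathcal H}$ factors over $(\mathcal P(\omega)/\mathrm{Fin})^+$.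
   Context: A tree partition of $\omega$ is a family $\langle A_s:s\in\omega^{<\omega}\rangle$ of infinite subsets of $\omega$ such that $A_\varnothing=\omega$, for each $s$ the family $\{A_{s^\frown n}:n\in\omega\}$ is a partition of $A_s$, and any two distinct points of $\omega$ lie in different cells $A_s\neq A_t$ with $|s|=|t|=n$ for some $n$. For $T\subseteq\omega^{<\omega}$ put $\mathrm{Succ}_T(s)=\{n:s^\frown n\in T\}$ and $D(T)=\{s\in T:\mathrm{Succ}_T(s)\text{ is infinite}\}$; $D^0(T)=T$, $D^{\alpha+1}(T)=D(D^\alpha(T))$, $D^\lambda(T)=\bigcap_{\beta<\lambda}D^\beta(T)$ for limit $\lambda$. For a node $s$, $\mathcal H(s)$ is the ideal on $A_s$ of all $X\subseteq A_s$ such that $\varnothing\notin D^\alpha(\{u\in\omega^{<\omega}:X\cap A_{s^\frown u}\text{ infinite}\})$ for some $\alpha<\omega_1$; $\mathcal H=\mathcal H(\varnothing)$. $\mathcal H^+=\mathcal P(\omega)\setminus\mathcal H$ and $\mathbb Q_{\mathcal H}=(\mathcal H^+,\le_{\mathcal H})$ with $X\le_{\mathcal H}Y\iff X\setminus Y\in\mathcal H$ (its separative quotient is $\mathbb B\setminus\{0\}$). $(\mathcal P(\omega)/\mathrm{Fin})^+$ is the set of nonzero elements of $\mathcal P(\omega)/\mathrm{Fin}$ as a forcing notion. A forcing projection $\pi:\mathbb P\to\mathbb Q$ is an order-preserving map such that for every $p\in\mathbb P$ and every $q\le\pi(p)$ there is $p'\le p$ with $\pi(p')\le q$. A subalgebra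 is regular if every maximal antichain of it remains a maximal antichain in the larger algebra. $\mathbb P$ factors over $\mathbb Q$ if $\mathbb P$ is forcing-equivalent to a two-step iteration $\mathbb Q*\dot{\mathbb R}$. *)

theory Defs
  imports "HOL-Library.Disjoint_Sets"
begin

section \<open>Countable ordinals\<close>

text \<open>The cardinal successor of the order of the natural numbers is a well-order of
  type \<open>\<omega>\<^sub>1\<close>, so the elements of its field, ordered by it, are the ordinals below \<open>\<omega>\<^sub>1\<close>.\<close>

typedef omega1 = "Field (cardSuc natLeq)"
  using Field_cardSuc_not_empty[OF natLeq_Card_order] by blast

lemma cardSuc_natLeq_Well_order: "Well_order (cardSuc natLeq)"
  using cardSuc_Card_order[OF natLeq_Card_order] by (simp add: card_order_on_def)

instantiation omega1 :: wellorder
begin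

definition less_eq_omega1 :: "omega1 \<Rightarrow> omega1 \<Rightarrow> bool" where
  "x \<le> y \<longleftrightarrow> (Rep_omega1 x, Rep_omega1 y) \<in> cardSuc natLeq"

definition less_omega1 :: "omega1 \<Rightarrow> omega1 \<Rightarrow> bool" where
  "x < y \<longleftrightarrow> x \<le> y \<and> x \<noteq> (y :: omega1)"

instance
proof -
  let ?r = "cardSuc natLeq"
  have lin: "linear_order_on (Field ?r) ?r" and wfr: "wf (?r - Id)"
    using cardSuc_natLeq_Well_order by (auto simp: well_order_on_def)
  have refl: "refl_on (Field ?r) ?r" and tr: "trans ?r" and anti: "antisym ?r"
    and tot: "total_on (Field ?r) ?r"
    using lin by (auto simp: linear_order_on_def partial_order_on_def preorder_on_def)
  have le_refl: "x \<le> x" for x :: omega1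
    using refl Rep_omega1[of x] by (auto simp: less_eq_omega1_def refl_on_def)
  have le_trans: "x \<le> z" if "x \<le> y" "y \<le> z" for x y z :: omega1
    using that unfolding less_eq_omega1_def by (rule transD[OF tr])
  have le_anti: "x = y" if "x \<le> y" "y \<le> x" for x y :: omega1
    using that antisymD[OF anti] unfolding less_eq_omega1_def by (metis Rep_omega1_inject)
  have le_tot: "x \<le> y \<or> y \<le> x" for x y :: omega1
  proof (cases "x = y")
    case False
    then have "Rep_omega1 x \<noteq> Rep_omega1 y"
      by (simp add: Rep_omega1_inject)
    then show ?thesis
      using tot Rep_omega1[of x] Rep_omega1[of y] by (simp add: less_eq_omega1_def total_on_def)
  qed (simp add: le_refl)
  have wf_less: "wf {(x, y :: omega1). x < y}"
  proof (rule wf_subset[OF wf_inv_image[OF wfr, of Rep_omega1]])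
    show "{(x, y :: omega1). x < y} \<subseteq> inv_image (?r - Id) Rep_omega1"
      by (auto simp: less_omega1_def less_eq_omega1_def inv_image_def Rep_omega1_inject)
  qed
  show "OFCLASS(omega1, wellorder_class)"
  proof intro_classes
    fix x y z :: omega1
    show "(x < y) = (x \<le> y \<and> \<not> y \<le> x)"
      using le_anti le_refl by (auto simp: less_omega1_def)
    show "x \<le> x" by (rule le_refl)
    show "x \<le> y \<Longrightarrow> y \<le> z \<Longrightarrow> x \<le> z" by (rule le_trans)
    show "x \<le> y \<Longrightarrow> y \<le> x \<Longrightarrow> x = y" by (rule le_anti)
    show "x \<le> y \<or> y \<le> x" by (rule le_tot)
  next
    fix P :: "omega1 \<Rightarrow> bool" and a
    assume "\<And>x. (\<And>y. y < x \<Longrightarrow> P y) \<Longrightarrow> P x"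
    then show "P a"
      using wf_induct_rule[OF wf_less, of P a] by blast
  qed
qed

end

definition immediate_succ :: "'o::wellorder \<Rightarrow> 'o \<Rightarrow> bool" where
  "immediate_succ \<beta> \<alpha> \<longleftrightarrow> \<beta> < \<alpha> \<and> \<not> (\<exists>\<gamma>. \<beta> < \<gamma> \<and> \<gamma> < \<alpha>)"

lemma immediate_succ_unique: "immediate_succ \<beta> \<alpha> \<Longrightarrow> immediate_succ \<gamma> \<alpha> \<Longrightarrow> \<gamma> = \<beta>"
  unfolding immediate_succ_def by (meson linorder_neqE)


section \<open>Derivatives of sets of nodes\<close>

text \<open>A node \<open>s \<in> \<omega>\<^bsup><\<omega>\<^esup>\<close> is a list and \<open>s\<close> extended by \<open>u\<close> is \<open>s @ u\<close>.\<close>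

definition Succ_set :: "nat list set \<Rightarrow> nat list \<Rightarrow> nat set" where
  "Succ_set T s = {n. s @ [n] \<in> T}"

definition tree_deriv :: "nat list set \<Rightarrow> nat list set" where
  "tree_deriv T = {s \<in> T. infinite (Succ_set T s)}"

function deriv_iter :: "omega1 \<Rightarrow> nat list set \<Rightarrow> nat list set" where
  "deriv_iter \<alpha> T =
     (if \<forall>\<beta>. \<alpha> \<le> \<beta> then T
      else if \<exists>\<beta>. immediate_succ \<beta> \<alpha>
        then tree_deriv (deriv_iter (THE \<beta>. immediate_succ \<beta> \<alpha>) T)
      else (\<Inter>\<beta>\<in>{..<\<alpha>}. deriv_iter \<beta> T))"
  by auto
termination
proof (relation "inv_image {(\<beta>, \<alpha>). \<beta> < \<alpha>} fst")
  show "wf (inv_image {(\<beta> :: omega1, \<alpha>). \<beta> < \<alpha>} (fst :: omega1 \<times> nat list set \<Rightarrow> omega1))"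
    by (intro wf_inv_image wf)
next
  fix \<alpha> :: omega1 and T :: "nat list set"
  assume "\<exists>\<beta>. immediate_succ \<beta> \<alpha>"
  then have "immediate_succ (THE \<beta>. immediate_succ \<beta> \<alpha>) \<alpha>"
    by (metis immediate_succ_unique the_equality)
  then show "((THE \<beta>. immediate_succ \<beta> \<alpha>, T), \<alpha>, T) \<in> inv_image {(\<beta>, \<alpha>). \<beta> < \<alpha>} fst"
    unfolding immediate_succ_def[of "THE \<beta>. immediate_succ \<beta> \<alpha>" \<alpha>]
    by (simp only: in_inv_image mem_Collect_eq case_prod_conv fst_conv)
next
  fix \<alpha> \<beta> :: omega1 and T :: "nat list set"
  assume "\<beta> \<in> {..<\<alpha>}"
  then show "((\<beta>, T), \<alpha>, T) \<in> inv_image {(\<beta>, \<alpha>). \<beta> < \<alpha>} fst"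
    by (simp only: in_inv_image mem_Collect_eq case_prod_conv fst_conv lessThan_iff)
qed

declare deriv_iter.simps [simp del]

lemma deriv_iter_zero: "(\<And>\<beta>. \<alpha> \<le> \<beta>) \<Longrightarrow> deriv_iter \<alpha> T = T"
  by (subst deriv_iter.simps) simp

lemma deriv_iter_succ:
  assumes "immediate_succ \<beta> \<alpha>"
  shows "deriv_iter \<alpha> T = tree_deriv (deriv_iter \<beta> T)"
proof -
  have "(THE \<beta>. immediate_succ \<beta> \<alpha>) = \<beta>"
    using assms by (blast intro: the_equality immediate_succ_unique)
  moreover have "\<not> (\<forall>\<beta>. \<alpha> \<le> \<beta>)"
    using assms by (auto simp: immediate_succ_def not_le)
  ultimately show ?thesis
    using assms by (subst deriv_iter.simps) metis
qed

lemma deriv_iter_limit: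
  assumes "\<beta> < \<alpha>" and "\<And>\<beta>. \<not> immediate_succ \<beta> \<alpha>"
  shows "deriv_iter \<alpha> T = (\<Inter>\<beta>\<in>{..<\<alpha>}. deriv_iter \<beta> T)"
proof -
  have "\<not> (\<forall>\<beta>. \<alpha> \<le> \<beta>)" and "\<not> (\<exists>\<beta>. immediate_succ \<beta> \<alpha>)"
    using assms by (auto simp: not_le)
  then show ?thesis
    by (subst deriv_iter.simps) presburger
qed


section \<open>Tree partitions and their ideals\<close>

definition tree_partition :: "(nat list \<Rightarrow> nat set) \<Rightarrow> bool" where
  "tree_partition A \<longleftrightarrow>
     (\<forall>s. infinite (A s)) \<and>
     A [] = UNIV \<and>
     (\<forall>s. disjoint_family (\<lambda>n. A (s @ [n])) \<and> (\<Union>n. A (s @ [n])) = A s) \<and>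
     (\<forall>x y. x \<noteq> y \<longrightarrow> (\<exists>s t. length s = length t \<and> x \<in> A s \<and> y \<in> A t \<and> A s \<noteq> A t))"

definition H_ideal :: "(nat list \<Rightarrow> nat set) \<Rightarrow> nat list \<Rightarrow> nat set set" where
  "H_ideal A s = {X. X \<subseteq> A s \<and> (\<exists>\<alpha>. [] \<notin> deriv_iter \<alpha> {u. infinite (X \<inter> A (s @ u))})}"

definition Fin :: "nat set set" where
  "Fin = {X. finite X}"


section \<open>Boolean algebras\<close>

record 'a bool_alg =
  elems :: "'a set"
  join :: "'a \<Rightarrow> 'a \<Rightarrow> 'a"
  meet :: "'a \<Rightarrow> 'a \<Rightarrow> 'a"
  compl :: "'a \<Rightarrow> 'a"
  zero :: 'a
  one :: 'a

definition boolean_algebra_on :: "'a bool_alg \<Rightarrow> bool" where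
  "boolean_algebra_on B \<longleftrightarrow>
     zero B \<in> elems B \<and> one B \<in> elems B \<and>
     (\<forall>x\<in>elems B. compl B x \<in> elems B \<and>
        join B x (zero B) = x \<and> meet B x (one B) = x \<and>
        join B x (compl B x) = one B \<and> meet B x (compl B x) = zero B) \<and>
     (\<forall>x\<in>elems B. \<forall>y\<in>elems B. join B x y \<in> elems B \<and> meet B x y \<in> elems B \<and>
        join B x y = join B y x \<and> meet B x y = meet B y x) \<and>
     (\<forall>x\<in>elems B. \<forall>y\<in>elems B. \<forall>z\<in>elems B.
        join B (join B x y) z = join B x (join B y z) \<and>
        meet B (meet B x y) z = meet B x (meet B y z) \<and>
        join B x (meet B y z) = meet B (join B x y) (join B x z) \<and>
        meet B x (join B y z) = join B (meet B x y) (meet B x z))"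

definition unital_boolean_embedding :: "'a bool_alg \<Rightarrow> 'b bool_alg \<Rightarrow> ('a \<Rightarrow> 'b) \<Rightarrow> bool" where
  "unital_boolean_embedding B C f \<longleftrightarrow>
     boolean_algebra_on B \<and> boolean_algebra_on C \<and>
     f ` elems B \<subseteq> elems C \<and> inj_on f (elems B) \<and>
     f (zero B) = zero C \<and> f (one B) = one C \<and>
     (\<forall>x\<in>elems B. f (compl B x) = compl C (f x)) \<and>
     (\<forall>x\<in>elems B. \<forall>y\<in>elems B.
        f (join B x y) = join C (f x) (f y) \<and> f (meet B x y) = meet C (f x) (f y))"

definition subalgebra :: "'a bool_alg \<Rightarrow> 'a set \<Rightarrow> bool" where
  "subalgebra B S \<longleftrightarrow>
     S \<subseteq> elems B \<and> zero B \<in> S \<and> one B \<in> S \<and> (\<forall>x\<in>S. compl B x \<in> S) \<and>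
     (\<forall>x\<in>S. \<forall>y\<in>S. join B x y \<in> S \<and> meet B x y \<in> S)"

definition antichain :: "'a bool_alg \<Rightarrow> 'a set \<Rightarrow> bool" where
  "antichain B M \<longleftrightarrow>
     M \<subseteq> elems B - {zero B} \<and> (\<forall>x\<in>M. \<forall>y\<in>M. x \<noteq> y \<longrightarrow> meet B x y = zero B)"

definition maximal_antichain :: "'a bool_alg \<Rightarrow> 'a set \<Rightarrow> bool" where
  "maximal_antichain B M \<longleftrightarrow>
     antichain B M \<and> (\<forall>M'. antichain B M' \<and> M \<subseteq> M' \<longrightarrow> M' = M)"

definition regular_subalgebra :: "'a bool_alg \<Rightarrow> 'a set \<Rightarrow> bool" where
  "regular_subalgebra B S \<longleftrightarrow>
     boolean_algebra_on B \<and> subalgebra B S \<and>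
     (\<forall>M. maximal_antichain (B\<lparr>elems := S\<rparr>) M \<longrightarrow> maximal_antichain B M)"

definition eq_mod :: "nat set set \<Rightarrow> (nat set \<times> nat set) set" where
  "eq_mod I = {(X, Y). (X - Y) \<union> (Y - X) \<in> I}"

definition class_mod :: "nat set set \<Rightarrow> nat set \<Rightarrow> nat set set" where
  "class_mod I X = eq_mod I `` {X}"

text \<open>The operations on classes are the unions of the classes obtained from all choices of
  representatives; for an ideal \<open>I\<close> all these choices give the same class.\<close>

definition Pow_mod :: "nat set set \<Rightarrow> nat set set bool_alg" where
  "Pow_mod I = \<lparr>
     elems = UNIV // eq_mod I,
     join = (\<lambda>a b. \<Union>X\<in>a. \<Union>Y\<in>b. class_mod I (X \<union> Y)),
     meet = (\<lambda>a b. \<Union>X\<in>a. \<Union>Y\<in>b. class_mod I (X \<inter> Y)),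
     compl = (\<lambda>a. \<Union>X\<in>a. class_mod I (- X)),
     zero = class_mod I {},
     one = class_mod I UNIV\<rparr>"


section \<open>Forcing notions\<close>

record 'p forcing =
  conds :: "'p set"
  le :: "'p \<Rightarrow> 'p \<Rightarrow> bool"

text \<open>Conditions are preordered (not necessarily antisymmetrically), with a weakest condition.\<close>

definition forcing_notion :: "'p forcing \<Rightarrow> bool" where
  "forcing_notion P \<longleftrightarrow>
     (\<forall>p\<in>conds P. le P p p) \<and>
     (\<forall>p\<in>conds P. \<forall>q\<in>conds P. \<forall>r\<in>conds P. le P p q \<and> le P q r \<longrightarrow> le P p r) \<and>
     (\<exists>e\<in>conds P. \<forall>p\<in>conds P. le P p e)"

definition nonzero_forcing :: "'a bool_alg \<Rightarrow> 'a forcing" where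
  "nonzero_forcing B = \<lparr>conds = elems B - {zero B}, le = (\<lambda>a b. meet B a b = a)\<rparr>"

definition QH :: "(nat list \<Rightarrow> nat set) \<Rightarrow> nat set forcing" where
  "QH A = \<lparr>conds = - H_ideal A [], le = (\<lambda>X Y. X - Y \<in> H_ideal A [])\<rparr>"

definition forcing_projection :: "'p forcing \<Rightarrow> 'q forcing \<Rightarrow> ('p \<Rightarrow> 'q) \<Rightarrow> bool" where
  "forcing_projection P Q f \<longleftrightarrow>
     forcing_notion P \<and> forcing_notion Q \<and> f ` conds P \<subseteq> conds Q \<and>
     (\<forall>p\<in>conds P. \<forall>p'\<in>conds P. le P p' p \<longrightarrow> le Q (f p') (f p)) \<and>
     (\<forall>p\<in>conds P. \<forall>q\<in>conds Q. le Q q (f p) \<longrightarrow>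
        (\<exists>p'\<in>conds P. le P p' p \<and> le Q (f p') q))"

text \<open>Forcing equivalence is isomorphism of the complete Boolean algebras of regular open
  sets. Regular open sets are those in the topology whose open sets are the downward closed
  sets of conditions; an order isomorphism of these algebras is a Boolean isomorphism.\<close>

definition RO :: "'p forcing \<Rightarrow> 'p set set" where
  "RO P = {U. U \<subseteq> conds P \<and>
     (\<forall>p\<in>U. \<forall>q\<in>conds P. le P q p \<longrightarrow> q \<in> U) \<and>
     (\<forall>p\<in>conds P. (\<forall>q\<in>conds P. le P q p \<longrightarrow> (\<exists>r\<in>U. le P r q)) \<longrightarrow> p \<in> U)}"

definition forcing_equivalent :: "'p forcing \<Rightarrow> 'q forcing \<Rightarrow> bool" where
  "forcing_equivalent P Q \<longleftrightarrow>
     (\<exists>f. bij_betw f (RO P) (RO Q) \<and> (\<forall>U\<in>RO P. \<forall>V\<in>RO P. U \<subseteq> V \<longleftrightarrow> f U \<subseteq> f V))"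


section \<open>Two-step iterations\<close>

text \<open>A set \<open>N\<close> of pairs \<open>(x, t)\<close> of a ground model object \<open>x\<close> and a condition \<open>t\<close> stands for the
  name consisting of all \<open>(check x, t)\<close>; a generic filter \<open>G\<close> evaluates it to the set of all \<open>x\<close> with
  \<open>(x, t) \<in> N\<close> for some \<open>t \<in> G\<close>. \<open>forces_in Q q x N\<close> says that \<open>q\<close> forces the canonical name of
  \<open>x\<close> to be in \<open>N\<close>: the conditions below some \<open>t\<close> with \<open>(x, t) \<in> N\<close> are dense below \<open>q\<close>.\<close>

definition forces_in :: "'q forcing \<Rightarrow> 'q \<Rightarrow> 'x \<Rightarrow> ('x \<times> 'q) set \<Rightarrow> bool" where
  "forces_in Q q x N \<longleftrightarrow>
     (\<forall>q'\<in>conds Q. le Q q' q \<longrightarrow>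
        (\<exists>q''\<in>conds Q. le Q q'' q' \<and> (\<exists>t\<in>conds Q. (x, t) \<in> N \<and> le Q q'' t)))"

record ('r, 'q) forcing_name =
  name_conds :: "('r \<times> 'q) set"
  name_le :: "(('r \<times> 'r) \<times> 'q) set"
  name_top :: 'r

text \<open>It is forced that \<open>(name_conds R, name_le R, name_top R)\<close> is a preorder with a greatest
  element. Every element of the evaluation of \<open>name_conds R\<close> is a ground model object, so the
  forced universal quantifiers become quantifiers over \<open>'r\<close>.\<close>

definition is_forcing_name :: "'q forcing \<Rightarrow> ('r, 'q) forcing_name \<Rightarrow> bool" where
  "is_forcing_name Q R \<longleftrightarrow>
     (\<forall>q\<in>conds Q.
        forces_in Q q (name_top R) (name_conds R) \<and>
        (\<forall>x. forces_in Q q x (name_conds R) \<longrightarrow>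
           forces_in Q q (x, x) (name_le R) \<and> forces_in Q q (x, name_top R) (name_le R)) \<and>
        (\<forall>x y z. forces_in Q q x (name_conds R) \<and> forces_in Q q y (name_conds R) \<and>
           forces_in Q q z (name_conds R) \<and>
           forces_in Q q (x, y) (name_le R) \<and> forces_in Q q (y, z) (name_le R) \<longrightarrow>
           forces_in Q q (x, z) (name_le R)))"

definition two_step :: "'q forcing \<Rightarrow> ('r, 'q) forcing_name \<Rightarrow> ('q \<times> 'r) forcing" where
  "two_step Q R = \<lparr>
     conds = {(q, x). q \<in> conds Q \<and> forces_in Q q x (name_conds R)},
     le = (\<lambda>(q', x') (q, x). le Q q' q \<and> forces_in Q q' (x', x) (name_le R))\<rparr>"

text \<open>The underlying set of the second iterand is taken to consist of conditions of \<open>P\<close>. This is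
  no loss of generality: if \<open>P\<close> is equivalent to some iteration over \<open>Q\<close>, it is equivalent to the
  iteration of \<open>Q\<close> with the quotient of \<open>P\<close> by the generic filter, which is a subset of \<open>P\<close>.\<close>

definition factors_over :: "'p forcing \<Rightarrow> 'q forcing \<Rightarrow> bool" where
  "factors_over P Q \<longleftrightarrow>
     forcing_notion P \<and> forcing_notion Q \<and>
     (\<exists>R :: ('p, 'q) forcing_name. is_forcing_name Q R \<and> forcing_equivalent P (two_step Q R))"


section \<open>The embedding and the projection\<close>

text \<open>Both maps are again unions over all representatives; such a map sends the class of \<open>X\<close> to the
  class given by \<open>X\<close> exactly when the prescription does not depend on the representative.\<close>

definition Phi_map :: "(nat list \<Rightarrow> nat set) \<Rightarrow> nat set set \<Rightarrow> nat set set" where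
  "Phi_map A b = (\<Union>B\<in>b. class_mod (H_ideal A []) (\<Union>n\<in>B. A [n]))"

definition pi_map :: "(nat list \<Rightarrow> nat set) \<Rightarrow> nat set set \<Rightarrow> nat set set" where
  "pi_map A a = (\<Union>X\<in>a. class_mod Fin {n. X \<inter> A [n] \<notin> H_ideal A [n]})"

end

theory Submission
  imports Defs "HOL-Library.Countable_Set_Type"
begin

text \<open>
  The ordinals in the definition of \<open>\<H>(s)\<close> serve only to remove nodes one after another. What
  remains of them is a recursion over the tree: a set \<open>X\<close> is in \<open>\<H>\<close> exactly if
  \<open>X \<inter> A\<^bsub>\<langle>n\<rangle>\<^esub>\<close> is in \<open>\<H>(\<langle>n\<rangle>)\<close> for all but finitely many \<open>n\<close>. One direction holds because a node
  with infinitely many indestructible children is itself indestructible, the other because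
  countably many countable ordinals have a countable bound. The recursion is captured by the
  inductive predicate \<open>small\<close>, and \<open>H_iff_finite_support\<close> states its outcome: with \<open>support A X\<close> the
  set of all \<open>n\<close> for which \<open>X \<inter> A\<^bsub>\<langle>n\<rangle>\<^esub>\<close> is not in \<open>\<H>(\<langle>n\<rangle>)\<close>, the ideal \<open>\<H>\<close> is the preimage of Fin
  under \<open>support A\<close>.

  Rule induction shows that smallness is preserved by unions, so \<open>support A\<close> commutes with unions.
  It also satisfies \<open>support A (X \<inter> saturation A B) = support A X \<inter> B\<close>, where \<open>saturation A B\<close> is the
  union of the cells indexed by \<open>B\<close>. Everything else follows from these facts. The
  Boolean homomorphism \<open>saturation A\<close> is a right inverse of \<open>support A\<close>, so it induces the embedding
  and \<open>support A\<close> induces a left inverse of it. Cutting \<open>X\<close> down to \<open>saturation A B\<close> shows that the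
  left inverse is a projection. The class of \<open>saturation A (support A X)\<close> is a reduction of the
  class of \<open>X\<close> to the copy of \<open>\<P>(\<omega>)/Fin\<close>, which makes the copy regular.

  For the factorisation, a projection \<open>f\<close> of \<open>P\<close> to \<open>Q\<close> that preserves the weakest condition yields
  the dense embedding \<open>p \<mapsto> (f p, p)\<close> of \<open>P\<close> into the iteration of \<open>Q\<close> with the quotient of \<open>P\<close> by
  the generic filter, and dense embeddings preserve the regular open algebra.
\<close>

unbundle cardinal_syntax


section \<open>Suprema of countable sets of countable ordinals\<close>

lemma omega1_initial_countable: "countable {\<beta>. \<beta> \<le> (\<alpha> :: omega1)}"
proof -
  let ?r = "cardSuc natLeq"
  have card: "Card_order ?r"
    by (rule cardSuc_Card_order[OF natLeq_Card_order])
  have "|underS ?r (Rep_omega1 \<alpha>)| <o ?r"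
    using card_of_underS[OF card] Rep_omega1 by blast
  then have "|underS ?r (Rep_omega1 \<alpha>)| \<le>o natLeq"
    using cardSuc_ordLeq_ordLess[OF natLeq_Card_order card_of_Card_order] by blast
  then have "countable (underS ?r (Rep_omega1 \<alpha>))"
    by (simp add: countable_card_le_natLeq)
  moreover have "Rep_omega1 ` {\<beta>. \<beta> < \<alpha>} \<subseteq> underS ?r (Rep_omega1 \<alpha>)"
    by (auto simp: underS_def less_omega1_def less_eq_omega1_def Rep_omega1_inject)
  ultimately have "countable (Rep_omega1 ` {\<beta>. \<beta> < \<alpha>})"
    by (rule countable_subset[rotated])
  then have "countable {\<beta>. \<beta> < \<alpha>}"
    by (rule countable_image_inj_on) (simp add: inj_on_def Rep_omega1_inject)
  moreover have "{\<beta>. \<beta> \<le> \<alpha>} = insert \<alpha> {\<beta>. \<beta> < \<alpha>}"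
    by auto
  ultimately show ?thesis
    by simp
qed

lemma omega1_uncountable: "uncountable (UNIV :: omega1 set)"
proof
  assume "countable (UNIV :: omega1 set)"
  then have "countable (range Rep_omega1)"
    by simp
  moreover have "range Rep_omega1 = Field (cardSuc natLeq)"
    by (rule type_definition.Rep_range[OF type_definition_omega1])
  ultimately have "|Field (cardSuc natLeq)| \<le>o natLeq"
    by (simp add: countable_card_le_natLeq)
  moreover have "|Field (cardSuc natLeq)| =o cardSuc natLeq"
    by (rule card_of_Field_ordIso[OF cardSuc_Card_order[OF natLeq_Card_order]])
  ultimately have "cardSuc natLeq \<le>o natLeq"
    using ordIso_symmetric ordIso_ordLeq_trans by blast
  then show False
    using cardSuc_greater[OF natLeq_Card_order] not_ordLeq_ordLess by blast
qed

text \<open>Otherwise \<open>\<omega>\<^sub>1\<close> would be a countable union of countable initial segments.\<close>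

lemma omega1_countable_bound:
  fixes f :: "nat \<Rightarrow> omega1"
  shows "\<exists>\<alpha>. \<forall>n. f n < \<alpha>"
proof (rule ccontr)
  assume "\<nexists>\<alpha>. \<forall>n. f n < \<alpha>"
  then have "UNIV = (\<Union>n. {\<beta>. \<beta> \<le> f n})"
    by (auto simp: not_less)
  moreover have "countable (\<Union>n. {\<beta>. \<beta> \<le> f n})"
    by (intro countable_UN omega1_initial_countable) auto
  ultimately show False
    using omega1_uncountable by simp
qed

lemma omega1_successor: "\<exists>\<gamma>. immediate_succ (\<alpha> :: omega1) \<gamma>"
proof -
  obtain \<delta> where "\<alpha> < \<delta>"
    using omega1_countable_bound[of "\<lambda>_. \<alpha>"] by auto
  then have "\<alpha> < (LEAST \<delta>. \<alpha> < \<delta>)"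
    by (rule LeastI)
  then have "immediate_succ \<alpha> (LEAST \<delta>. \<alpha> < \<delta>)"
    unfolding immediate_succ_def using not_less_Least by blast
  then show ?thesis ..
qed


section \<open>The ideals as well-founded recursions\<close>

lemma omega1_cases [case_names zero succ limit]:
  fixes \<alpha> :: omega1
  obtains "\<And>\<beta>. \<alpha> \<le> \<beta>" | \<beta> where "immediate_succ \<beta> \<alpha>"
    | \<beta> where "\<beta> < \<alpha>" "\<And>\<gamma>. \<not> immediate_succ \<gamma> \<alpha>"
  by (meson not_le)

lemma deriv_iter_antimono:
  assumes "\<alpha> \<le> \<beta>"
  shows "deriv_iter \<beta> T \<subseteq> deriv_iter \<alpha> T"
  using assms
proof (induction \<beta> rule: less_induct)
  case (less \<beta>)
  show ?case
  proof (cases \<beta> rule: omega1_cases)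
    case zero
    then show ?thesis using less.prems by (metis antisym order_refl)
  next
    case (succ \<gamma>)
    show ?thesis
    proof (cases "\<alpha> = \<beta>")
      case False
      then have "\<alpha> \<le> \<gamma>" "\<gamma> < \<beta>"
        using succ less.prems unfolding immediate_succ_def by (auto simp: not_less)
      then have "deriv_iter \<gamma> T \<subseteq> deriv_iter \<alpha> T"
        using less.IH by blast
      then show ?thesis
        using deriv_iter_succ[OF succ, of T] by (auto simp: tree_deriv_def)
    qed simp
  next
    case (limit \<gamma>)
    show ?thesis
    proof (cases "\<alpha> = \<beta>")
      case False
      then show ?thesis
        using deriv_iter_limit[OF limit, of T] less.prems by auto
    qed simp
  qed
qed

text \<open>Membership in \<open>\<H>(s)\<close> without ordinals: a set is small at \<open>s\<close> if its trace on the cell is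
  finite, or if it is small at all but finitely many children. The rank of a
  derivation of smallness bounds the number of derivatives needed to remove the node.\<close>

inductive small :: "(nat list \<Rightarrow> nat set) \<Rightarrow> nat set \<Rightarrow> nat list \<Rightarrow> bool" for A X where
  small_finite: "finite (X \<inter> A s) \<Longrightarrow> small A X s"
| small_step: "finite F \<Longrightarrow> (\<And>n. n \<notin> F \<Longrightarrow> small A X (s @ [n])) \<Longrightarrow> small A X s"

text \<open>Nodes at which a set is not small have infinitely many such children, so no derivative can
  ever remove one of them.\<close>

lemma not_small_survives:
  assumes "\<not> small A X (s @ u)"
  shows "u \<in> deriv_iter \<alpha> {u. infinite (X \<inter> A (s @ u))}"
  using assms
proof (induction \<alpha> arbitrary: u rule: less_induct)
  case (less \<alpha>)
  show ?case
  proof (cases \<alpha> rule: omega1_cases)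
    case zero
    then show ?thesis
      using less.prems by (auto simp: deriv_iter_zero intro: small_finite)
  next
    case (succ \<beta>)
    let ?D = "deriv_iter \<beta> {u. infinite (X \<inter> A (s @ u))}"
    have "\<beta> < \<alpha>"
      using succ by (simp add: immediate_succ_def)
    then have D: "u \<in> ?D" if "\<not> small A X (s @ u)" for u
      using less.IH that by blast
    have "infinite {n. \<not> small A X ((s @ u) @ [n])}"
      using less.prems small_step[of "{n. \<not> small A X ((s @ u) @ [n])}" A X "s @ u"] by blast
    moreover have "{n. \<not> small A X ((s @ u) @ [n])} \<subseteq> Succ_set ?D u"
      using D by (auto simp: Succ_set_def)
    ultimately have "infinite (Succ_set ?D u)"
      using finite_subset by blast
    then show ?thesis
      using D less.prems by (simp add: deriv_iter_succ[OF succ] tree_deriv_def)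
  next
    case (limit \<beta>)
    then show ?thesis
      using less by (simp add: deriv_iter_limit[OF limit])
  qed
qed

text \<open>If almost all children of a node disappear at some countable stage, then, countable stages
  being bounded, they have all disappeared at one common stage, and the node itself is removed
  at the next one.\<close>

lemma small_removed:
  assumes "small A X t" and "t = s @ u"
  shows "\<exists>\<alpha>. u \<notin> deriv_iter \<alpha> {u. infinite (X \<inter> A (s @ u))}"
  using assms
proof (induction arbitrary: u rule: small.induct)
  case (small_finite t)
  let ?z = "LEAST \<alpha> :: omega1. True"
  have "?z \<le> \<beta>" for \<beta>
    by (simp add: Least_le)
  then show ?case
    using small_finite by (intro exI[of _ ?z]) (simp add: deriv_iter_zero)
next
  case (small_step F t)
  let ?T = "{u. infinite (X \<inter> A (s @ u))}"
  have "\<exists>\<alpha>. n \<notin> F \<longrightarrow> u @ [n] \<notin> deriv_iter \<alpha> ?T" for n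
    using small_step.IH[of n "u @ [n]"] small_step.prems by auto
  then obtain f where f: "\<And>n. n \<notin> F \<Longrightarrow> u @ [n] \<notin> deriv_iter (f n) ?T"
    by metis
  obtain \<alpha> where \<alpha>: "\<And>n. f n < \<alpha>"
    using omega1_countable_bound[of f] by blast
  obtain \<gamma> where \<gamma>: "immediate_succ \<alpha> \<gamma>"
    using omega1_successor by blast
  have "Succ_set (deriv_iter \<alpha> ?T) u \<subseteq> F"
    using f deriv_iter_antimono[OF less_imp_le[OF \<alpha>]] unfolding Succ_set_def by blast
  then have "finite (Succ_set (deriv_iter \<alpha> ?T) u)"
    using small_step.hyps(1) finite_subset by blast
  then have "u \<notin> deriv_iter \<gamma> ?T"
    by (simp add: deriv_iter_succ[OF \<gamma>] tree_deriv_def)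
  then show ?case ..
qed

lemma H_ideal_iff_small: "X \<in> H_ideal A s \<longleftrightarrow> X \<subseteq> A s \<and> small A X s"
  using not_small_survives[of A X s "[]"] small_removed[of A X s s "[]"]
  by (auto simp: H_ideal_def)

lemma small_child_iff: "small A X s \<longleftrightarrow> finite (X \<inter> A s) \<or> finite {n. \<not> small A X (s @ [n])}"
proof
  assume "small A X s"
  then show "finite (X \<inter> A s) \<or> finite {n. \<not> small A X (s @ [n])}"
  proof cases
    case (small_step F)
    then have "{n. \<not> small A X (s @ [n])} \<subseteq> F"
      by blast
    then show ?thesis
      using small_step(1) finite_subset by blast
  qed simp
qed (auto intro: small_finite small_step[of "{n. \<not> small A X (s @ [n])}"])

lemma small_mono: "small A X s \<Longrightarrow> Y \<subseteq> X \<Longrightarrow> small A Y s"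
proof (induction rule: small.induct)
  case (small_finite s)
  then have "finite (Y \<inter> A s)"
    by (meson Int_mono finite_subset order_refl)
  then show ?case by (rule small.small_finite)
next
  case (small_step F s)
  then have "small A Y (s @ [n])" if "n \<notin> F" for n
    using that by blast
  then show ?case
    by (rule small.small_step[OF small_step.hyps(1)])
qed

context
  fixes A :: "nat list \<Rightarrow> nat set"
  assumes tp: "tree_partition A"
begin

lemma cell_child: "A (s @ [n]) \<subseteq> A s"
  using tp unfolding tree_partition_def by blast

lemma cell_infinite: "infinite (A s)"
  using tp unfolding tree_partition_def by blast

lemma small_trace_cong:
  assumes "small A X s" and "X \<inter> A s = Y \<inter> A s"
  shows "small A Y s"
  using assms(1,2)
proof (induction rule: small.induct)
  case (small_finite s)
  then show ?case by (simp add: small.small_finite)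
next
  case (small_step F s)
  have "X \<inter> A (s @ [n]) = Y \<inter> A (s @ [n])" for n
    using small_step.prems cell_child[of s n] by blast
  then have "small A Y (s @ [n])" if "n \<notin> F" for n
    by (rule small_step.IH[OF that])
  then show ?case
    by (rule small.small_step[OF small_step.hyps(1)])
qed

lemma small_Un_finite:
  assumes "small A X s" and "finite (Y \<inter> A s)"
  shows "small A (X \<union> Y) s"
  using assms(1,2)
proof (induction rule: small.induct)
  case (small_finite s)
  then show ?case by (simp add: small.small_finite Int_Un_distrib2)
next
  case (small_step F s)
  have "finite (Y \<inter> A (s @ [n]))" for n
    using small_step.prems cell_child[of s n] by (meson Int_mono finite_subset order_refl)
  then have "small A (X \<union> Y) (s @ [n])" if "n \<notin> F" for n
    by (rule small_step.IH[OF that])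
  then show ?case
    by (rule small.small_step[OF small_step.hyps(1)])
qed

text \<open>Induction on the derivation for \<open>X\<close>, inverting the last step of the derivation for \<open>Y\<close>: two
  recursion steps combine to one whose exceptional set is the union of theirs, and a base case on
  either side is absorbed by the other derivation.\<close>

lemma small_Un:
  assumes "small A X s" and "small A Y s"
  shows "small A (X \<union> Y) s"
  using assms(1,2)
proof (induction rule: small.induct)
  case (small_finite s)
  then show ?case
    using small_Un_finite[of Y s X] by (simp add: Un_commute)
next
  case (small_step F s)
  note IH = small_step.IH
  have "small A X s"
    by (rule small.small_step[OF small_step.hyps])
  show ?case
    using small_step.prems
  proof cases
    case small_finite
    then show ?thesis
      using small_Un_finite[of X s Y] \<open>small A X s\<close> by simp
  next
    case (small_step F')
    have "small A (X \<union> Y) (s @ [n])" if "n \<notin> F \<union> F'" for n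
      using that small_step(2) by (intro IH) auto
    then show ?thesis
      by (rule small.small_step[OF finite_UnI[OF \<open>finite F\<close> small_step(1)]])
  qed
qed

text \<open>Some child avoids the finite exceptional set of a recursion step, so a derivation for a whole
  cell would lead down to a cell with a finite trace.\<close>

lemma not_small_cell:
  assumes "small A X s" and "A s \<subseteq> X"
  shows False
  using assms(1,2)
proof (induction rule: small.induct)
  case (small_finite s)
  then show ?case using cell_infinite[of s] by (simp add: Int_absorb1)
next
  case (small_step F s)
  obtain n where "n \<notin> F"
    using ex_new_if_finite[OF infinite_UNIV_nat small_step.hyps(1)] by blast
  moreover have "A (s @ [n]) \<subseteq> X"
    using small_step.prems cell_child[of s n] by (rule subset_trans[rotated])
  ultimately show ?case
    by (rule small_step.IH)
qed

end


section \<open>Supports on the first level\<close>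

definition support :: "(nat list \<Rightarrow> nat set) \<Rightarrow> nat set \<Rightarrow> nat set" where
  "support A X = {n. X \<inter> A [n] \<notin> H_ideal A [n]}"

definition saturation :: "(nat list \<Rightarrow> nat set) \<Rightarrow> nat set \<Rightarrow> nat set" where
  "saturation A B = (\<Union>n\<in>B. A [n])"

lemma saturation_empty: "saturation A {} = {}"
  by (simp add: saturation_def)

lemma saturation_Un: "saturation A (B \<union> C) = saturation A B \<union> saturation A C"
  by (auto simp: saturation_def)

context
  fixes A :: "nat list \<Rightarrow> nat set"
  assumes tp: "tree_partition A"
begin

lemma first_level_unique: "x \<in> A [m] \<Longrightarrow> x \<in> A [n] \<Longrightarrow> m = n"
  using tp unfolding tree_partition_def disjoint_family_on_def
  by (metis IntI UNIV_I append_Nil empty_iff)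

lemma first_level_cover: "(\<Union>n. A [n]) = UNIV"
  using tp unfolding tree_partition_def by (metis (no_types, lifting) SUP_cong append_Nil)

lemma support_iff: "n \<in> support A X \<longleftrightarrow> \<not> small A X [n]"
  using small_trace_cong[OF tp, of "X \<inter> A [n]" "[n]" X]
    small_mono[of A X "[n]" "X \<inter> A [n]"]
  by (auto simp: support_def H_ideal_iff_small)

text \<open>A finite set has empty support, so at the root the base case of smallness is subsumed by the
  recursion step.\<close>

lemma H_iff_finite_support: "X \<in> H_ideal A [] \<longleftrightarrow> finite (support A X)"
proof -
  have root: "A [] = UNIV"
    using tp by (simp add: tree_partition_def)
  have "support A X = {}" if "finite X"
    using that by (simp add: set_eq_iff support_iff small_finite)
  moreover have "support A X = {n. \<not> small A X ([] @ [n])}"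
    by (auto simp: support_iff)
  ultimately show ?thesis
    using small_child_iff[of A X "[]"] by (auto simp: H_ideal_iff_small root)
qed

lemma support_UNIV: "support A UNIV = UNIV"
  using not_small_cell[OF tp, of UNIV] by (auto simp: support_iff)

lemma support_Un: "support A (X \<union> Y) = support A X \<union> support A Y"
  using small_Un[OF tp] small_mono by (auto simp: support_iff)

lemma support_mono: "X \<subseteq> Y \<Longrightarrow> support A X \<subseteq> support A Y"
  using small_mono by (auto simp: support_iff)

lemma support_diff: "support A X - support A Y \<subseteq> support A (X - Y)"
  using support_Un[of Y "X - Y"] support_mono[of X "Y \<union> (X - Y)"] by blast

text \<open>On a first-level cell, intersecting with a union of such cells either changes nothing or
  leaves nothing.\<close>

lemma support_Int_saturation: "support A (X \<inter> saturation A B) = support A X \<inter> B"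
proof (rule set_eqI)
  fix n
  have "(X \<inter> saturation A B) \<inter> A [n] = (if n \<in> B then X \<inter> A [n] else {})"
    by (auto simp: saturation_def dest: first_level_unique)
  moreover have "{} \<in> H_ideal A [n]"
    by (simp add: H_ideal_iff_small small_finite)
  ultimately show "n \<in> support A (X \<inter> saturation A B) \<longleftrightarrow> n \<in> support A X \<inter> B"
    by (simp add: support_def)
qed

lemma support_saturation: "support A (saturation A B) = B"
  using support_Int_saturation[of UNIV B] by (simp add: support_UNIV)

lemma saturation_UNIV: "saturation A UNIV = UNIV"
  by (simp add: saturation_def first_level_cover)

lemma saturation_Int: "saturation A (B \<inter> C) = saturation A B \<inter> saturation A C"
  by (auto simp: saturation_def) (metis IntI first_level_unique)

lemma saturation_Compl: "saturation A (- B) = - saturation A B"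
  using saturation_Un[of A B "- B"] saturation_Int[of B "- B"] saturation_UNIV saturation_empty
  by (auto simp: Compl_partition)

lemma saturation_diff: "saturation A (B - C) = saturation A B - saturation A C"
  by (simp add: Diff_eq saturation_Int saturation_Compl)

end


section \<open>Quotients of the power set by an ideal\<close>

locale set_ideal =
  fixes I :: "nat set set"
  assumes empty_mem: "{} \<in> I"
    and subset_mem: "X \<in> I \<Longrightarrow> Y \<subseteq> X \<Longrightarrow> Y \<in> I"
    and Un_mem: "X \<in> I \<Longrightarrow> Y \<in> I \<Longrightarrow> X \<union> Y \<in> I"
begin

lemma Un_mem_iff: "X \<union> Y \<in> I \<longleftrightarrow> X \<in> I \<and> Y \<in> I"
  using Un_mem subset_mem by (meson Un_upper1 Un_upper2)

lemma diff_trans_mem: "X - Y \<in> I \<Longrightarrow> Y - Z \<in> I \<Longrightarrow> X - Z \<in> I"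
  by (rule subset_mem[OF Un_mem[of "X - Y" "Y - Z"]]) auto

lemma equiv_eq_mod: "equiv UNIV (eq_mod I)"
proof (rule equivI)
  show "refl (eq_mod I)"
    by (simp add: refl_on_def eq_mod_def empty_mem)
  show "sym (eq_mod I)"
    by (auto simp: sym_def eq_mod_def Un_commute)
  show "trans (eq_mod I)"
    unfolding trans_def eq_mod_def by (simp add: Un_mem_iff) (blast intro: diff_trans_mem)
qed simp

lemma class_mod_eq_iff: "class_mod I X = class_mod I Y \<longleftrightarrow> X - Y \<in> I \<and> Y - X \<in> I"
  unfolding class_mod_def using eq_equiv_class_iff[OF equiv_eq_mod, of X Y]
  by (simp add: eq_mod_def Un_mem_iff)

lemma mem_class_mod: "Y \<in> class_mod I X \<longleftrightarrow> X - Y \<in> I \<and> Y - X \<in> I"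
  by (simp add: class_mod_def eq_mod_def Un_mem_iff)

lemma elems_Pow_mod: "elems (Pow_mod I) = range (class_mod I)"
  by (auto simp: Pow_mod_def quotient_def class_mod_def)

text \<open>A union over all representatives collapses to a single class as soon as its members agree.\<close>

lemma UN_class_mod:
  assumes "\<And>Y. X - Y \<in> I \<Longrightarrow> Y - X \<in> I \<Longrightarrow> F Y = F X"
  shows "(\<Union>Y\<in>class_mod I X. F Y) = F X"
proof -
  have "F Y = F X" if "Y \<in> class_mod I X" for Y
    using that assms[of Y] by (simp add: mem_class_mod)
  moreover have "X \<in> class_mod I X"
    by (simp add: mem_class_mod empty_mem)
  ultimately show ?thesis
    by blast
qed

lemma compl_Pow_mod: "compl (Pow_mod I) (class_mod I X) = class_mod I (- X)"
proof -
  have swap: "- U - - V = V - U" for U V :: "nat set"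
    by blast
  have "compl (Pow_mod I) (class_mod I X) = (\<Union>Y\<in>class_mod I X. class_mod I (- Y))"
    by (simp add: Pow_mod_def)
  also have "\<dots> = class_mod I (- X)"
    by (rule UN_class_mod) (simp only: class_mod_eq_iff swap)
  finally show ?thesis .
qed

lemma join_Pow_mod: "join (Pow_mod I) (class_mod I X) (class_mod I Y) = class_mod I (X \<union> Y)"
proof -
  have "X \<union> Y - (X' \<union> Y') \<in> I" if "X - X' \<in> I" "Y - Y' \<in> I" for X X' Y Y'
    by (rule subset_mem[OF Un_mem[OF that]]) auto
  then have cong: "class_mod I (X' \<union> Y') = class_mod I (X \<union> Y)"
    if "X - X' \<in> I" "X' - X \<in> I" "Y - Y' \<in> I" "Y' - Y \<in> I" for X X' Y Y'
    using that by (simp add: class_mod_eq_iff)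
  have "(\<Union>Y'\<in>class_mod I Y. class_mod I (X' \<union> Y')) = class_mod I (X' \<union> Y)" for X'
    by (rule UN_class_mod, rule cong) (simp_all add: empty_mem)
  then have "join (Pow_mod I) (class_mod I X) (class_mod I Y) =
      (\<Union>X'\<in>class_mod I X. class_mod I (X' \<union> Y))"
    by (simp add: Pow_mod_def)
  also have "\<dots> = class_mod I (X \<union> Y)"
    by (rule UN_class_mod, rule cong) (simp_all add: empty_mem)
  finally show ?thesis .
qed

lemma meet_Pow_mod: "meet (Pow_mod I) (class_mod I X) (class_mod I Y) = class_mod I (X \<inter> Y)"
proof -
  have "X \<inter> Y - (X' \<inter> Y') \<in> I" if "X - X' \<in> I" "Y - Y' \<in> I" for X X' Y Y'
    by (rule subset_mem[OF Un_mem[OF that]]) auto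
  then have cong: "class_mod I (X' \<inter> Y') = class_mod I (X \<inter> Y)"
    if "X - X' \<in> I" "X' - X \<in> I" "Y - Y' \<in> I" "Y' - Y \<in> I" for X X' Y Y'
    using that by (simp add: class_mod_eq_iff)
  have "(\<Union>Y'\<in>class_mod I Y. class_mod I (X' \<inter> Y')) = class_mod I (X' \<inter> Y)" for X'
    by (rule UN_class_mod, rule cong) (simp_all add: empty_mem)
  then have "meet (Pow_mod I) (class_mod I X) (class_mod I Y) =
      (\<Union>X'\<in>class_mod I X. class_mod I (X' \<inter> Y))"
    by (simp add: Pow_mod_def)
  also have "\<dots> = class_mod I (X \<inter> Y)"
    by (rule UN_class_mod, rule cong) (simp_all add: empty_mem)
  finally show ?thesis .
qed

lemma zero_Pow_mod: "zero (Pow_mod I) = class_mod I {}"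
  by (simp add: Pow_mod_def)

lemma one_Pow_mod: "one (Pow_mod I) = class_mod I UNIV"
  by (simp add: Pow_mod_def)

lemmas Pow_mod_simps =
  elems_Pow_mod compl_Pow_mod join_Pow_mod meet_Pow_mod zero_Pow_mod one_Pow_mod

lemma class_mod_eq_zero_iff: "class_mod I X = zero (Pow_mod I) \<longleftrightarrow> X \<in> I"
  by (simp add: zero_Pow_mod class_mod_eq_iff empty_mem)

lemma boolean_algebra_Pow_mod: "boolean_algebra_on (Pow_mod I)"
  unfolding boolean_algebra_on_def
  by (simp add: Pow_mod_simps) (intro conjI allI arg_cong[of _ _ "class_mod I"]; blast)

lemma conds_nonzero_Pow_mod: "conds (nonzero_forcing (Pow_mod I)) = class_mod I ` (- I)"
  unfolding nonzero_forcing_def elems_Pow_mod using class_mod_eq_zero_iff by auto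

lemma le_nonzero_Pow_mod:
  "le (nonzero_forcing (Pow_mod I)) (class_mod I X) (class_mod I Y) \<longleftrightarrow> X - Y \<in> I"
proof -
  have "X \<inter> Y - X = {}" "X - X \<inter> Y = X - Y"
    by auto
  then have "X \<inter> Y - X \<in> I" "X - X \<inter> Y \<in> I \<longleftrightarrow> X - Y \<in> I"
    by (simp_all only: empty_mem)
  then show ?thesis
    by (simp add: nonzero_forcing_def meet_Pow_mod class_mod_eq_iff)
qed

lemma forcing_notion_Pow_mod:
  assumes "UNIV \<notin> I"
  shows "forcing_notion (nonzero_forcing (Pow_mod I))"
  unfolding forcing_notion_def conds_nonzero_Pow_mod
proof (intro conjI)
  show "\<exists>e\<in>class_mod I ` (- I). \<forall>p\<in>class_mod I ` (- I). le (nonzero_forcing (Pow_mod I)) p e"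
    using assms by (intro bexI[of _ "class_mod I UNIV"]) (auto simp: le_nonzero_Pow_mod empty_mem)
qed (auto simp: le_nonzero_Pow_mod empty_mem dest: diff_trans_mem)

end

lemma set_ideal_Fin: "set_ideal Fin"
  by standard (auto simp: Fin_def intro: finite_subset)


section \<open>Regular subalgebras and forcing equivalence\<close>

lemma boolean_algebra_onD:
  assumes "boolean_algebra_on B" and "x \<in> elems B"
  shows "compl B x \<in> elems B" "join B x (zero B) = x" "meet B x (one B) = x"
    "join B x (compl B x) = one B" "meet B x (compl B x) = zero B"
    "y \<in> elems B \<Longrightarrow> join B x y \<in> elems B" "y \<in> elems B \<Longrightarrow> meet B x y \<in> elems B"
    "y \<in> elems B \<Longrightarrow> meet B x y = meet B y x"
    "y \<in> elems B \<Longrightarrow> z \<in> elems B \<Longrightarrow>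
      meet B x (join B y z) = join B (meet B x y) (meet B x z)"
  using assms unfolding boolean_algebra_on_def by blast+

lemma subalgebra_image:
  assumes "unital_boolean_embedding B C f"
  shows "subalgebra C (f ` elems B)"
proof -
  have "boolean_algebra_on B"
    using assms by (simp add: unital_boolean_embedding_def)
  then have closed: "zero B \<in> elems B" "one B \<in> elems B"
    "\<And>x. x \<in> elems B \<Longrightarrow> compl B x \<in> elems B"
    "\<And>x y. x \<in> elems B \<Longrightarrow> y \<in> elems B \<Longrightarrow> join B x y \<in> elems B \<and> meet B x y \<in> elems B"
    by (simp_all add: boolean_algebra_on_def)
  have f: "f ` elems B \<subseteq> elems C" "zero C = f (zero B)" "one C = f (one B)"
    "\<And>x. x \<in> elems B \<Longrightarrow> compl C (f x) = f (compl B x)"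
    "\<And>x y. x \<in> elems B \<Longrightarrow> y \<in> elems B \<Longrightarrow> join C (f x) (f y) = f (join B x y)"
    "\<And>x y. x \<in> elems B \<Longrightarrow> y \<in> elems B \<Longrightarrow> meet C (f x) (f y) = f (meet B x y)"
    using assms by (simp_all add: unital_boolean_embedding_def)
  show ?thesis
    unfolding subalgebra_def by (auto simp: f(2-) closed) (use f(1) in blast)
qed

lemma meet_idem:
  assumes B: "boolean_algebra_on B" and x: "x \<in> elems B"
  shows "meet B x x = x"
proof -
  note ax = boolean_algebra_onD[OF B]
  have "meet B x x = join B (meet B x x) (zero B)"
    by (rule ax(2)[OF ax(7)[OF x x], symmetric])
  also have "\<dots> = join B (meet B x x) (meet B x (compl B x))"
    by (simp only: ax(5)[OF x])
  also have "\<dots> = meet B x (join B x (compl B x))"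
    by (rule ax(9)[OF x x ax(1)[OF x], symmetric])
  also have "\<dots> = x"
    by (simp only: ax(3,4)[OF x])
  finally show ?thesis .
qed

text \<open>The usual criterion for regularity. A reduction \<open>r\<close> of \<open>x\<close> to \<open>S\<close> meets some member of any
  maximal antichain of \<open>S\<close>, hence so does \<open>x\<close>, and \<open>x\<close> cannot be added to that antichain.\<close>

lemma regular_subalgebra_if_reductions:
  assumes B: "boolean_algebra_on B" and S: "subalgebra B S"
    and red: "\<And>x. x \<in> elems B \<Longrightarrow> x \<noteq> zero B \<Longrightarrow>
      \<exists>r\<in>S. r \<noteq> zero B \<and> (\<forall>s\<in>S. meet B s r \<noteq> zero B \<longrightarrow> meet B s x \<noteq> zero B)"
  shows "regular_subalgebra B S"
  unfolding regular_subalgebra_def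
proof (intro conjI allI impI B S)
  fix M
  assume M: "maximal_antichain (B\<lparr>elems := S\<rparr>) M"
  have SB: "S \<subseteq> elems B"
    using S by (simp add: subalgebra_def)
  have MS: "M \<subseteq> S" and antiS: "antichain (B\<lparr>elems := S\<rparr>) M"
    using M by (auto simp: maximal_antichain_def antichain_def)
  have anti: "antichain B M"
    using antiS SB by (auto simp: antichain_def)
  have comm: "meet B x y = meet B y x" if "x \<in> S" "y \<in> S" for x y
    using boolean_algebra_onD(8)[OF B] that SB by blast
  have meets: "\<exists>m\<in>M. meet B m r \<noteq> zero B" if r: "r \<in> S" "r \<noteq> zero B" for r
  proof (rule ccontr)
    assume disj: "\<not> (\<exists>m\<in>M. meet B m r \<noteq> zero B)"
    then have "r \<notin> M"
      using meet_idem[OF B, of r] r SB by auto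
    moreover have "meet B r m = zero B" if "m \<in> M" for m
      using comm[of r m] that disj r MS by auto
    then have "antichain (B\<lparr>elems := S\<rparr>) (insert r M)"
      using antiS r disj by (auto simp: antichain_def)
    then have "insert r M = M"
      using M unfolding maximal_antichain_def by blast
    ultimately show False
      by blast
  qed
  show "maximal_antichain B M"
    unfolding maximal_antichain_def
  proof (intro conjI allI impI anti)
    fix M'
    assume M': "antichain B M' \<and> M \<subseteq> M'"
    have "x \<in> M" if "x \<in> M'" for x
    proof (rule ccontr)
      assume "x \<notin> M"
      have "x \<in> elems B" "x \<noteq> zero B"
        using M' that by (auto simp: antichain_def)
      then obtain r where "r \<in> S" "r \<noteq> zero B"
        and r: "\<And>s. s \<in> S \<Longrightarrow> meet B s r \<noteq> zero B \<Longrightarrow> meet B s x \<noteq> zero B"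
        using red by blast
      obtain m where m: "m \<in> M" "meet B m r \<noteq> zero B"
        using meets[OF \<open>r \<in> S\<close> \<open>r \<noteq> zero B\<close>] by blast
      then have "meet B m x \<noteq> zero B"
        using r MS by blast
      moreover have "m \<in> M'" "m \<noteq> x"
        using m M' \<open>x \<notin> M\<close> by auto
      ultimately show False
        using M' that by (simp add: antichain_def)
    qed
    then show "M' = M"
      using M' by blast
  qed
qed

text \<open>A dense order embedding induces an isomorphism of the regular open algebras: the preimage
  map has as its inverse the map sending \<open>U\<close> to the conditions below which the image of \<open>U\<close> is
  dense.\<close>

lemma forcing_equivalent_dense_embedding:
  assumes Q: "forcing_notion Q"
    and e: "\<And>p. p \<in> conds P \<Longrightarrow> e p \<in> conds Q"
    and emb: "\<And>p p'. p \<in> conds P \<Longrightarrow> p' \<in> conds P \<Longrightarrow> le Q (e p') (e p) \<longleftrightarrow> le P p' p"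
    and dense: "\<And>q. q \<in> conds Q \<Longrightarrow> \<exists>p\<in>conds P. le Q (e p) q"
  shows "forcing_equivalent P Q"
proof -
  have refl: "le Q q q" if "q \<in> conds Q" for q
    using Q that by (simp add: forcing_notion_def)
  have trans: "le Q p r" if "le Q p q" "le Q q r" "p \<in> conds Q" "q \<in> conds Q" "r \<in> conds Q" for p q r
    using Q that unfolding forcing_notion_def by blast
  define h where "h V = {p \<in> conds P. e p \<in> V}" for V
  define k where "k U = {q \<in> conds Q. \<forall>q'\<in>conds Q. le Q q' q \<longrightarrow> (\<exists>u\<in>U. le Q (e u) q')}" for U
  have h_RO: "h V \<in> RO P" if V: "V \<in> RO Q" for V
  proof -
    have down: "\<And>p q. p \<in> V \<Longrightarrow> q \<in> conds Q \<Longrightarrow> le Q q p \<Longrightarrow> q \<in> V"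
      and reg: "\<And>p. p \<in> conds Q \<Longrightarrow> (\<And>q. q \<in> conds Q \<Longrightarrow> le Q q p \<Longrightarrow> \<exists>r\<in>V. le Q r q) \<Longrightarrow> p \<in> V"
      and sub: "V \<subseteq> conds Q"
      using V unfolding RO_def by blast+
    have "p \<in> h V" if p: "p \<in> conds P" and d: "\<forall>q\<in>conds P. le P q p \<longrightarrow> (\<exists>r\<in>h V. le P r q)" for p
    proof -
      have "\<exists>r\<in>V. le Q r q" if q: "q \<in> conds Q" "le Q q (e p)" for q
      proof -
        obtain p' where p': "p' \<in> conds P" "le Q (e p') q"
          using dense q by blast
        then have "le Q (e p') (e p)"
          using trans[of "e p'" q "e p"] q e p by blast
        then have "le P p' p"
          using emb p p' by blast
        then obtain r where r: "r \<in> conds P" "e r \<in> V" "le P r p'"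
          using d p' by (auto simp: h_def)
        then have "le Q (e r) q"
          using trans[of "e r" "e p'" q] emb[of p' r] e p' q by blast
        then show ?thesis
          using r by blast
      qed
      then have "e p \<in> V"
        using reg e p by blast
      then show ?thesis
        by (simp add: h_def p)
    qed
    moreover have "q \<in> h V" if "p \<in> h V" "q \<in> conds P" "le P q p" for p q
      using that down[of "e p" "e q"] e emb[of p q] by (auto simp: h_def)
    moreover have "h V \<subseteq> conds P"
      by (auto simp: h_def)
    ultimately show ?thesis
      unfolding RO_def by blast
  qed
  have h_le: "V \<subseteq> W \<longleftrightarrow> h V \<subseteq> h W" if V: "V \<in> RO Q" and W: "W \<in> RO Q" for V W
  proof
    show "V \<subseteq> W \<Longrightarrow> h V \<subseteq> h W"
      by (auto simp: h_def)
    assume hVW: "h V \<subseteq> h W"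
    show "V \<subseteq> W"
    proof
      fix q
      assume "q \<in> V"
      then have q: "q \<in> conds Q"
        using V by (auto simp: RO_def)
      have "\<exists>r\<in>W. le Q r q'" if q': "q' \<in> conds Q" "le Q q' q" for q'
      proof -
        have "q' \<in> V"
          using V \<open>q \<in> V\<close> q' unfolding RO_def by blast
        obtain p where p: "p \<in> conds P" "le Q (e p) q'"
          using dense q' by blast
        then have "p \<in> h V"
          using V \<open>q' \<in> V\<close> e unfolding RO_def h_def by blast
        then show ?thesis
          using hVW p by (auto simp: h_def)
      qed
      then show "q \<in> W"
        using W q unfolding RO_def by blast
    qed
  qed
  have surj: "\<exists>V\<in>RO Q. h V = U" if U: "U \<in> RO P" for U
  proof
    have sub: "U \<subseteq> conds P"
      and down: "\<And>p q. p \<in> U \<Longrightarrow> q \<in> conds P \<Longrightarrow> le P q p \<Longrightarrow> q \<in> U"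
      and reg: "\<And>p. p \<in> conds P \<Longrightarrow> (\<And>q. q \<in> conds P \<Longrightarrow> le P q p \<Longrightarrow> \<exists>r\<in>U. le P r q) \<Longrightarrow> p \<in> U"
      using U unfolding RO_def by blast+
    have "q \<in> k U" if q: "q \<in> conds Q"
      and d: "\<forall>q'\<in>conds Q. le Q q' q \<longrightarrow> (\<exists>r\<in>k U. le Q r q')" for q
    proof -
      have "\<exists>u\<in>U. le Q (e u) q'" if q': "q' \<in> conds Q" "le Q q' q" for q'
      proof -
        obtain r where r: "r \<in> k U" "le Q r q'"
          using d q' by blast
        then have "r \<in> conds Q"
          by (simp add: k_def)
        then obtain u where u: "u \<in> U" "le Q (e u) r"
          using r refl by (auto simp: k_def)
        then have "le Q (e u) q'"
          using trans[of "e u" r q'] \<open>r \<in> conds Q\<close> r q' e sub by blast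
        then show ?thesis
          using u by blast
      qed
      then show ?thesis
        using q by (simp add: k_def)
    qed
    moreover have "q' \<in> k U" if q: "q \<in> k U" and q': "q' \<in> conds Q" "le Q q' q" for q q'
      using that trans[of _ q' q] by (auto simp: k_def)
    moreover have "k U \<subseteq> conds Q"
      by (auto simp: k_def)
    ultimately show "k U \<in> RO Q"
      unfolding RO_def by blast
    show "h (k U) = U"
    proof
      show "U \<subseteq> h (k U)"
      proof
        fix p
        assume "p \<in> U"
        then have p: "p \<in> conds P"
          using sub by blast
        have "\<exists>u\<in>U. le Q (e u) q'" if q': "q' \<in> conds Q" "le Q q' (e p)" for q'
        proof -
          obtain u where u: "u \<in> conds P" "le Q (e u) q'"
            using dense q' by blast
          then have "le Q (e u) (e p)"
            using trans[of "e u" q' "e p"] q' e p by blast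
          then have "u \<in> U"
            using down \<open>p \<in> U\<close> u emb p by blast
          then show ?thesis
            using u by blast
        qed
        then show "p \<in> h (k U)"
          using e p by (simp add: h_def k_def)
      qed
      show "h (k U) \<subseteq> U"
      proof
        fix p
        assume "p \<in> h (k U)"
        then have p: "p \<in> conds P"
          and d: "\<And>q'. q' \<in> conds Q \<Longrightarrow> le Q q' (e p) \<Longrightarrow> \<exists>u\<in>U. le Q (e u) q'"
          by (auto simp: h_def k_def)
        have "\<exists>u\<in>U. le P u p'" if p': "p' \<in> conds P" "le P p' p" for p'
          using d[of "e p'"] e p p' emb sub by blast
        then show "p \<in> U"
          using reg p by blast
      qed
    qed
  qed
  have "inj_on h (RO Q)"
    using h_le by (intro inj_onI) blast
  moreover have "h ` RO Q = RO P"
    using h_RO surj by blast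
  ultimately have bij: "bij_betw h (RO Q) (RO P)"
    by (simp add: bij_betw_def)
  let ?g = "inv_into (RO Q) h"
  have "bij_betw ?g (RO P) (RO Q)"
    by (rule bij_betw_inv_into[OF bij])
  moreover have "U \<subseteq> V \<longleftrightarrow> ?g U \<subseteq> ?g V" if "U \<in> RO P" "V \<in> RO P" for U V
    using h_le[of "?g U" "?g V"] bij_betw_inv_into_right[OF bij] that
      bij_betwE[OF \<open>bij_betw ?g (RO P) (RO Q)\<close>] by simp
  ultimately show ?thesis
    unfolding forcing_equivalent_def by blast
qed

text \<open>A projection of \<open>P\<close> to \<open>Q\<close> that preserves the weakest condition presents \<open>P\<close> as an iteration
  over \<open>Q\<close>. The second iterand is the quotient of \<open>P\<close> by the generic filter: the conditions whose
  projection is in the filter, with the order of \<open>P\<close>. Then \<open>p\<close> is sent to the pair of \<open>f p\<close> and \<open>p\<close>;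
  the defining property of a projection is exactly what makes these pairs dense.\<close>

lemma factors_over_projection:
  fixes P :: "'p forcing" and Q :: "'q forcing"
  assumes f: "forcing_projection P Q f"
    and top: "e \<in> conds P" "\<And>p. p \<in> conds P \<Longrightarrow> le P p e"
      "\<And>q. q \<in> conds Q \<Longrightarrow> le Q q (f e)"
  shows "factors_over P Q"
proof -
  have P: "forcing_notion P" and Q: "forcing_notion Q"
    and fQ: "\<And>p. p \<in> conds P \<Longrightarrow> f p \<in> conds Q"
    and mono: "\<And>p p'. p \<in> conds P \<Longrightarrow> p' \<in> conds P \<Longrightarrow> le P p' p \<Longrightarrow> le Q (f p') (f p)"
    and proj: "\<And>p q. p \<in> conds P \<Longrightarrow> q \<in> conds Q \<Longrightarrow> le Q q (f p) \<Longrightarrow>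
      \<exists>p'\<in>conds P. le P p' p \<and> le Q (f p') q"
    using f unfolding forcing_projection_def by blast+
  have reflP: "le P p p" if "p \<in> conds P" for p
    using P that by (simp add: forcing_notion_def)
  have transP: "le P p r" if "le P p q" "le P q r" "p \<in> conds P" "q \<in> conds P" "r \<in> conds P" for p q r
    using P that unfolding forcing_notion_def by blast
  have reflQ: "le Q q q" if "q \<in> conds Q" for q
    using Q that by (simp add: forcing_notion_def)
  have transQ: "le Q p r" if "le Q p q" "le Q q r" "p \<in> conds Q" "q \<in> conds Q" "r \<in> conds Q" for p q r
    using Q that unfolding forcing_notion_def by blast
  define R where "R = \<lparr>name_conds = {(p, f p) | p. p \<in> conds P},
    name_le = {((p', p), t) | p' p t. p' \<in> conds P \<and> p \<in> conds P \<and> le P p' p \<and> t \<in> conds Q},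
    name_top = e\<rparr>"
  have cond: "forces_in Q q p (name_conds R) \<longleftrightarrow> p \<in> conds P \<and>
      (\<forall>q'\<in>conds Q. le Q q' q \<longrightarrow> (\<exists>q''\<in>conds Q. le Q q'' q' \<and> le Q q'' (f p)))"
    if "q \<in> conds Q" for q p
    using that reflQ fQ unfolding forces_in_def R_def by auto
  have le: "forces_in Q q (p', p) (name_le R) \<longleftrightarrow> p' \<in> conds P \<and> p \<in> conds P \<and> le P p' p"
    if "q \<in> conds Q" for q p p'
    using that reflQ unfolding forces_in_def R_def by auto
  have "forces_in Q q e (name_conds R)" if "q \<in> conds Q" for q
    using that cond top reflQ by blast
  then have "is_forcing_name Q R"
    unfolding is_forcing_name_def using le cond top reflP transP by (auto simp: R_def)
  let ?I = "two_step Q R"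
  have conds_I: "(q, p) \<in> conds ?I \<longleftrightarrow> q \<in> conds Q \<and> forces_in Q q p (name_conds R)" for q p
    by (simp add: two_step_def)
  have le_I: "forcing.le ?I (q', p') (q, p) \<longleftrightarrow> forcing.le Q q' q \<and> forces_in Q q' (p', p) (name_le R)"
    for q q' p p'
    by (simp add: two_step_def)
  have "forcing_equivalent P ?I"
  proof (rule forcing_equivalent_dense_embedding[where e = "\<lambda>p. (f p, p)"])
    show "forcing_notion ?I"
      unfolding forcing_notion_def
    proof (intro conjI ballI impI)
      fix x
      assume "x \<in> conds ?I"
      then show "forcing.le ?I x x"
        using cond reflP reflQ by (cases x) (auto simp: conds_I le_I le)
    next
      fix x y z
      assume "x \<in> conds ?I" "y \<in> conds ?I" "z \<in> conds ?I"
        and "forcing.le ?I x y \<and> forcing.le ?I y z"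
      then show "forcing.le ?I x z"
        by (cases x; cases y; cases z) (simp add: conds_I le_I le, blast intro: transP transQ)
    next
      show "\<exists>t\<in>conds ?I. \<forall>x\<in>conds ?I. forcing.le ?I x t"
      proof (intro bexI ballI)
        show "(f e, e) \<in> conds ?I"
          using \<open>\<And>q. q \<in> conds Q \<Longrightarrow> forces_in Q q e (name_conds R)\<close> fQ top(1)
          by (simp add: conds_I)
        show "forcing.le ?I x (f e, e)" if "x \<in> conds ?I" for x
          using that cond top by (cases x) (auto simp: conds_I le_I le)
      qed
    qed
    show "(f p, p) \<in> conds ?I" if "p \<in> conds P" for p
      using that by (auto simp: conds_I cond fQ intro: reflQ)
    show "forcing.le ?I (f p', p') (f p, p) \<longleftrightarrow> forcing.le P p' p"
      if "p \<in> conds P" "p' \<in> conds P" for p p'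
      using that mono by (auto simp: le_I le fQ)
    show "\<exists>p\<in>conds P. forcing.le ?I (f p, p) x" if "x \<in> conds ?I" for x
    proof -
      obtain q p where x: "x = (q, p)"
        by (cases x)
      have q: "q \<in> conds Q" and forced: "forces_in Q q p (name_conds R)"
        using that by (simp_all add: x conds_I)
      have p: "p \<in> conds P"
        and d: "\<forall>q'\<in>conds Q. forcing.le Q q' q \<longrightarrow>
          (\<exists>q''\<in>conds Q. forcing.le Q q'' q' \<and> forcing.le Q q'' (f p))"
        using forced cond[OF q] by blast+
      obtain q' where q': "q' \<in> conds Q" "forcing.le Q q' q" "forcing.le Q q' (f p)"
        using d q reflQ by blast
      obtain p' where p': "p' \<in> conds P" "forcing.le P p' p" "forcing.le Q (f p') q'"
        using proj[OF p q'(1,3)] by blast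
      have "forcing.le Q (f p') q"
        using transQ[OF p'(3) q'(2)] fQ p' q' q by blast
      then show ?thesis
        using p p' by (intro bexI[of _ p']) (simp_all add: x le_I le fQ)
    qed
  qed
  then show ?thesis
    unfolding factors_over_def using P Q \<open>is_forcing_name Q R\<close> by blast
qed


section \<open>The embedding and the projection on classes\<close>

context
  fixes A :: "nat list \<Rightarrow> nat set"
  assumes tp: "tree_partition A"
begin

lemmas support_simps =
  support_Un[OF tp] support_UNIV[OF tp] support_saturation[OF tp] support_Int_saturation[OF tp]

lemma set_ideal_H: "set_ideal (H_ideal A [])"
proof
  show "{} \<in> H_ideal A []"
    using support_saturation[OF tp, of "{}"]
    by (simp add: H_iff_finite_support[OF tp] saturation_empty)
  show "Y \<in> H_ideal A []" if "X \<in> H_ideal A []" "Y \<subseteq> X" for X Y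
    using that support_mono[OF tp, of Y X] by (auto simp: H_iff_finite_support[OF tp] intro: finite_subset)
  show "X \<union> Y \<in> H_ideal A []" if "X \<in> H_ideal A []" "Y \<in> H_ideal A []" for X Y
    using that by (simp add: H_iff_finite_support[OF tp] support_simps)
qed

interpretation H: set_ideal "H_ideal A []"
  by (rule set_ideal_H)

interpretation Fin: set_ideal Fin
  by (rule set_ideal_Fin)

lemma UNIV_not_H: "UNIV \<notin> H_ideal A []"
  by (simp add: H_iff_finite_support[OF tp] support_simps)

lemma saturation_H_iff: "saturation A B \<in> H_ideal A [] \<longleftrightarrow> B \<in> Fin"
  by (simp add: H_iff_finite_support[OF tp] support_simps Fin_def)

lemma saturation_class_eq_iff:
  "class_mod (H_ideal A []) (saturation A B) = class_mod (H_ideal A []) (saturation A C) \<longleftrightarrow>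
    class_mod Fin B = class_mod Fin C"
  by (simp add: H.class_mod_eq_iff Fin.class_mod_eq_iff saturation_H_iff
      flip: saturation_diff[OF tp])

lemma support_diff_Fin: "X - Y \<in> H_ideal A [] \<Longrightarrow> support A X - support A Y \<in> Fin"
  using support_diff[OF tp, of X Y] by (auto simp: H_iff_finite_support[OF tp] Fin_def intro: finite_subset)

lemma Phi_map_class:
  "Phi_map A (class_mod Fin B) = class_mod (H_ideal A []) (saturation A B)"
  unfolding Phi_map_def saturation_def[symmetric]
  by (rule Fin.UN_class_mod) (simp add: saturation_class_eq_iff Fin.class_mod_eq_iff)

lemma pi_map_class:
  "pi_map A (class_mod (H_ideal A []) X) = class_mod Fin (support A X)"
  unfolding pi_map_def support_def[symmetric]
  by (rule H.UN_class_mod) (simp add: Fin.class_mod_eq_iff support_diff_Fin)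

lemma Phi_map_embedding:
  "unital_boolean_embedding (Pow_mod Fin) (Pow_mod (H_ideal A [])) (Phi_map A)"
  unfolding unital_boolean_embedding_def
  by (auto simp: Fin.boolean_algebra_Pow_mod H.boolean_algebra_Pow_mod Fin.Pow_mod_simps
      H.Pow_mod_simps Phi_map_class saturation_class_eq_iff saturation_empty saturation_UNIV[OF tp]
      saturation_Un saturation_Int[OF tp] saturation_Compl[OF tp] intro!: inj_onI)

text \<open>Below a positive set \<open>X\<close>, any \<open>B\<close> almost contained in its support is realised as a support,
  up to finite sets, by cutting \<open>X\<close> down to the cells indexed by \<open>B\<close>.\<close>

lemma support_projection:
  "forcing_projection (QH A) (nonzero_forcing (Pow_mod Fin)) (\<lambda>X. class_mod Fin (support A X))"
  unfolding forcing_projection_def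
proof (intro conjI ballI impI)
  let ?Q = "nonzero_forcing (Pow_mod Fin)"
  have conds_QH: "conds (QH A) = - H_ideal A []" and le_QH: "le (QH A) = (\<lambda>X Y. X - Y \<in> H_ideal A [])"
    by (simp_all add: QH_def)
  show "forcing_notion (QH A)"
    unfolding forcing_notion_def conds_QH le_QH
    using UNIV_not_H by (auto simp: H.empty_mem intro: H.diff_trans_mem intro!: bexI[of _ UNIV])
  show "forcing_notion ?Q"
    by (rule Fin.forcing_notion_Pow_mod) (simp add: Fin_def)
  show "(\<lambda>X. class_mod Fin (support A X)) ` conds (QH A) \<subseteq> conds ?Q"
    unfolding Fin.conds_nonzero_Pow_mod
    by (auto simp: conds_QH H_iff_finite_support[OF tp] Fin_def[THEN eqset_imp_iff])
  fix X
  assume X: "X \<in> conds (QH A)"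
  show "le ?Q (class_mod Fin (support A X')) (class_mod Fin (support A X))"
    if "le (QH A) X' X" for X'
    using that by (simp add: le_QH Fin.le_nonzero_Pow_mod support_diff_Fin)
  fix q
  assume "q \<in> conds ?Q" and "le ?Q q (class_mod Fin (support A X))"
  then obtain B where q: "q = class_mod Fin B" and B: "infinite B" "finite (B - support A X)"
    by (auto simp: Fin.conds_nonzero_Pow_mod Fin.le_nonzero_Pow_mod) (auto simp: Fin_def)
  have "B = (support A X \<inter> B) \<union> (B - support A X)"
    by blast
  then have "infinite (support A X \<inter> B)"
    using B by (metis finite_UnI)
  then have "X \<inter> saturation A B \<in> conds (QH A)"
    by (simp add: conds_QH H_iff_finite_support[OF tp] support_simps)
  moreover have "X \<inter> saturation A B - X = {}"
    by blast
  then have "le (QH A) (X \<inter> saturation A B) X"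
    by (simp only: le_QH H.empty_mem)
  moreover have "support A X \<inter> B - B = {}"
    by blast
  then have "le ?Q (class_mod Fin (support A (X \<inter> saturation A B))) q"
    by (simp only: q Fin.le_nonzero_Pow_mod support_simps Fin.empty_mem)
  ultimately show "\<exists>X'\<in>conds (QH A). le (QH A) X' X \<and> le ?Q (class_mod Fin (support A X')) q"
    by blast
qed

lemma pi_map_projection:
  "forcing_projection (nonzero_forcing (Pow_mod (H_ideal A []))) (nonzero_forcing (Pow_mod Fin))
    (pi_map A)"
proof -
  have conds: "conds (nonzero_forcing (Pow_mod (H_ideal A []))) =
      class_mod (H_ideal A []) ` conds (QH A)"
    by (simp add: H.conds_nonzero_Pow_mod QH_def)
  have le: "le (nonzero_forcing (Pow_mod (H_ideal A []))) (class_mod (H_ideal A []) X)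
      (class_mod (H_ideal A []) Y) = le (QH A) X Y" for X Y
    by (simp add: H.le_nonzero_Pow_mod QH_def)
  show ?thesis
    using support_projection H.forcing_notion_Pow_mod[OF UNIV_not_H]
    unfolding forcing_projection_def conds by (simp add: le pi_map_class image_image)
qed

text \<open>The reduction of \<open>[X]\<close> to the copy of \<open>\<P>(\<omega>)/Fin\<close> is the class of the union of the cells in
  the support of \<open>X\<close>.\<close>

lemma Phi_map_regular:
  "regular_subalgebra (Pow_mod (H_ideal A [])) (Phi_map A ` elems (Pow_mod Fin))"
proof (rule regular_subalgebra_if_reductions[OF H.boolean_algebra_Pow_mod
      subalgebra_image[OF Phi_map_embedding]])
  let ?B = "Pow_mod (H_ideal A [])" and ?c = "class_mod (H_ideal A [])"
  fix x
  assume "x \<in> elems ?B" "x \<noteq> zero ?B"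
  then obtain X where x: "x = ?c X" and X: "X \<notin> H_ideal A []"
    unfolding H.elems_Pow_mod using H.class_mod_eq_zero_iff by blast
  have S: "Phi_map A ` elems (Pow_mod Fin) = range (\<lambda>B. ?c (saturation A B))"
    by (simp add: Fin.elems_Pow_mod image_image Phi_map_class)
  let ?r = "?c (saturation A (support A X))"
  have "?r \<noteq> zero ?B"
    using X by (simp add: H.class_mod_eq_zero_iff H_iff_finite_support[OF tp] support_simps)
  moreover have "meet ?B (?c (saturation A B)) x \<noteq> zero ?B"
    if "meet ?B (?c (saturation A B)) ?r \<noteq> zero ?B" for B
  proof -
    have "infinite (B \<inter> support A X)"
      using that by (simp add: H.meet_Pow_mod H.class_mod_eq_zero_iff H_iff_finite_support[OF tp]
          support_simps)
    then show ?thesis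
      by (simp add: x H.meet_Pow_mod H.class_mod_eq_zero_iff H_iff_finite_support[OF tp]
          support_simps Int_commute)
  qed
  ultimately show "\<exists>r\<in>Phi_map A ` elems (Pow_mod Fin). r \<noteq> zero ?B \<and>
      (\<forall>s\<in>Phi_map A ` elems (Pow_mod Fin). meet ?B s r \<noteq> zero ?B \<longrightarrow> meet ?B s x \<noteq> zero ?B)"
    unfolding S by blast
qed

lemma QH_factors: "factors_over (QH A) (nonzero_forcing (Pow_mod Fin))"
proof (rule factors_over_projection[OF support_projection])
  show "UNIV \<in> conds (QH A)"
    using UNIV_not_H by (simp add: QH_def)
  show "le (QH A) X UNIV" for X
    by (simp add: QH_def H.empty_mem)
  show "le (nonzero_forcing (Pow_mod Fin)) q (class_mod Fin (support A UNIV))"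
    if "q \<in> conds (nonzero_forcing (Pow_mod Fin))" for q
    using that by (auto simp: Fin.conds_nonzero_Pow_mod Fin.le_nonzero_Pow_mod support_simps
        Fin.empty_mem)
qed

end

theorem theorem8p4:
  fixes A :: "nat list \<Rightarrow> nat set"
  assumes "tree_partition A"
  shows
    "(\<lambda>B. class_mod (H_ideal A []) (\<Union>n\<in>B. A [n])) respects eq_mod Fin \<and>
     (\<forall>B. Phi_map A (class_mod Fin B) = class_mod (H_ideal A []) (\<Union>n\<in>B. A [n])) \<and>
     unital_boolean_embedding (Pow_mod Fin) (Pow_mod (H_ideal A [])) (Phi_map A) \<and>
     (\<forall>X. pi_map A (class_mod (H_ideal A []) X) = class_mod Fin {n. X \<inter> A [n] \<notin> H_ideal A [n]}) \<and>
     forcing_projection (nonzero_forcing (Pow_mod (H_ideal A [])))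
       (nonzero_forcing (Pow_mod Fin)) (pi_map A) \<and>
     (\<forall>b\<in>elems (Pow_mod Fin). pi_map A (Phi_map A b) = b) \<and>
     regular_subalgebra (Pow_mod (H_ideal A [])) (Phi_map A ` elems (Pow_mod Fin)) \<and>
     factors_over (QH A) (nonzero_forcing (Pow_mod Fin))"
proof (intro conjI)
  interpret Fin: set_ideal Fin
    by (rule set_ideal_Fin)
  have "class_mod Fin B = class_mod Fin C" if "(B, C) \<in> eq_mod Fin" for B C
    using equiv_class_eq[OF Fin.equiv_eq_mod that] by (simp add: class_mod_def)
  then show "(\<lambda>B. class_mod (H_ideal A []) (\<Union>n\<in>B. A [n])) respects eq_mod Fin"
    by (auto simp: congruent_def saturation_class_eq_iff[OF assms] simp flip: saturation_def)
  show "\<forall>B. Phi_map A (class_mod Fin B) = class_mod (H_ideal A []) (\<Union>n\<in>B. A [n])"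
    using Phi_map_class[OF assms] by (simp add: saturation_def)
  show "\<forall>X. pi_map A (class_mod (H_ideal A []) X) = class_mod Fin {n. X \<inter> A [n] \<notin> H_ideal A [n]}"
    using pi_map_class[OF assms] by (simp add: support_def)
  show "\<forall>b\<in>elems (Pow_mod Fin). pi_map A (Phi_map A b) = b"
    by (auto simp: Fin.elems_Pow_mod Phi_map_class[OF assms] pi_map_class[OF assms]
        support_saturation[OF assms])
qed (fact Phi_map_embedding[OF assms] pi_map_projection[OF assms] Phi_map_regular[OF assms]
    QH_factors[OF assms])+

end
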